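(* Let $P$ be a binary partial group. Then the simplicial set $BP$ is a Chermak partial group.
   Context: **Notation.** For expressions $a,b$ which may or may not be defined, $a \asymp b$ means that either both are undefined, or both are defined and $a=b$. **Binary partial groups.** A unital partial magma is a set $P$ with a partially defined binary operation $P\times P \nrightarrow P$, written $(a,b)\mapsto ab$, and an element $1\in P$ such that $a1\asymp a\asymp 1a$ for all $a\in P$. A binary partial group is a unital partial magma $P$ such that for each $a\in P$ there exists $a^\dagger\in P$ satisfying both of the following for all $b\in P$: (1) if $ab$ is defined then $a^\dagger(ab)\asymp b$; (2) if $ba$ is defined then $(ba)a^\dagger\asymp b$. The element $a^\dagger$ is unique. **The simplicial set $BP$.** For a binary partial group $P$, let $BP_n\subseteq P^{\times n}$ be the set of words $w$ of length $n$ such that every full parenthesization of $w$ gives a valid iterated multiplication in $P$ and all of these multiplications have the same value. So $BP_0=\ast$ (the empty word), $BP_1=P$, and $BP_2$ is the set of multipliable pairs. Inner face maps multiply two adjacent entries, outer face maps discard the first or last entry, and degeneracy maps insert the unit $1$ in some position. **Chermak partial groups.** Let $\Upsilon$ be the category with objects $[n]=\{0,1,\dots,n\}$, $n\ge 0$, and morphisms all functions. A symmetric set is a functor $X\colon \Upsilon^{\mathrm{op}}\to \mathsf{Set}$; restricting along $\Delta^{\mathrm{op}}\to\Upsilon^{\mathrm{op}}$ gives its underlying simplicial set. The Segal map $\mathscr{E}_n\colon X_n\to X_1^{\times n}$ of a simplicial set has $i$-th component ($1\le i\le n$) induced by $[1]\to[n]$, $0\mapsto i-1$, $1\mapsto i$.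 A simplicial set is edgy if $\mathscr{E}_n$ is injective for all $n\ge 2$; a symmetric set is spiny if its underlying simplicial set is edgy; a simplicial or symmetric set $X$ is reduced if $X_0$ is a one-point set. A (Chermak) partial group is a reduced spiny symmetric set. It is known that the forgetful functor from spiny symmetric sets to simplicial sets is fully faithful, and that an edgy simplicial set $X$ is in its essential image if and only if there is a simplicial map $\dagger\colon X^{\mathrm{op}}\to X$ such that (i) $\dagger\dagger^{\mathrm{op}}=\mathrm{id}_X$, and (ii) if $x\in X_n$ has $\mathscr{E}_n(x)=(a_1,\dots,a_n)$, then there is $y\in X_{2n}$ with $\mathscr{E}_{2n}(y)=(a_n^\dagger,\dots,a_1^\dagger,a_1,\dots,a_n)$ whose total product (the edge of $y$ from vertex $0$ to vertex $2n$) is a degenerate 1-simplex. Accordingly, a simplicial set is said to be a Chermak partial group if it is reduced, edgy, and admits such a map $\dagger$. *)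

theory Defs
  imports Main "HOL-Library.FuncSet"
begin

section \<open>Binary partial groups\<close>

text \<open>
  A partial operation is a function into the option type: \<open>mult a b = None\<close> means that the
  product is undefined. The relation \<open>\<asymp>\<close> between possibly undefined expressions is then equality
  of options.
\<close>

locale unital_partial_magma =
  fixes P :: "'a set" and mult :: "'a \<Rightarrow> 'a \<Rightarrow> 'a option" and one :: 'a
  assumes mult_closed: "mult a b = Some c \<Longrightarrow> a \<in> P \<and> b \<in> P \<and> c \<in> P"
    and one_closed: "one \<in> P"
    and mult_one: "a \<in> P \<Longrightarrow> mult a one = Some a"
    and one_mult: "a \<in> P \<Longrightarrow> mult one a = Some a"

locale binary_partial_group = unital_partial_magma P mult one
  for P :: "'a set" and mult :: "'a \<Rightarrow> 'a \<Rightarrow> 'a option" and one :: 'a +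
  assumes dagger_exists: "a \<in> P \<Longrightarrow> \<exists>a'\<in>P. \<forall>b\<in>P.
      (\<forall>c. mult a b = Some c \<longrightarrow> mult a' c = Some b) \<and>
      (\<forall>c. mult b a = Some c \<longrightarrow> mult c a' = Some b)"


section \<open>Simplicial sets\<close>

text \<open>
  The morphisms \<open>[m] \<rightarrow> [n]\<close> of the simplex category, as extensional functions on \<open>{0..m}\<close>.
\<close>

definition ord_maps :: "nat \<Rightarrow> nat \<Rightarrow> (nat \<Rightarrow> nat) set" where
  "ord_maps m n = {\<theta> \<in> {..m} \<rightarrow>\<^sub>E {..n}. mono_on {..m} \<theta>}"

text \<open>
  \<open>action X m n \<theta>\<close> is the map \<open>X\<^sub>n \<rightarrow> X\<^sub>m\<close> induced by \<open>\<theta> : [m] \<rightarrow> [n]\<close>; only its values for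
  \<open>\<theta> \<in> ord_maps m n\<close> and on \<open>X\<^sub>n\<close> are meaningful.
\<close>

record 'x sset =
  simplices :: "nat \<Rightarrow> 'x set"
  action :: "nat \<Rightarrow> nat \<Rightarrow> (nat \<Rightarrow> nat) \<Rightarrow> 'x \<Rightarrow> 'x"

definition simplicial_set :: "'x sset \<Rightarrow> bool" where
  "simplicial_set X \<longleftrightarrow>
     (\<forall>m n. \<forall>\<theta>\<in>ord_maps m n. action X m n \<theta> \<in> simplices X n \<rightarrow> simplices X m) \<and>
     (\<forall>n. \<forall>x\<in>simplices X n. action X n n (\<lambda>i\<in>{..n}. i) x = x) \<and>
     (\<forall>k m n. \<forall>\<phi>\<in>ord_maps k m. \<forall>\<theta>\<in>ord_maps m n. \<forall>x\<in>simplices X n.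
        action X k n (compose {..k} \<theta> \<phi>) x = action X k m \<phi> (action X m n \<theta> x))"

definition simplicial_map :: "'x sset \<Rightarrow> 'y sset \<Rightarrow> (nat \<Rightarrow> 'x \<Rightarrow> 'y) \<Rightarrow> bool" where
  "simplicial_map X Y f \<longleftrightarrow>
     (\<forall>n. f n \<in> simplices X n \<rightarrow> simplices Y n) \<and>
     (\<forall>m n. \<forall>\<theta>\<in>ord_maps m n. \<forall>x\<in>simplices X n.
        f m (action X m n \<theta> x) = action Y m n \<theta> (f n x))"

text \<open>The opposite simplicial set is obtained by reversing the order of all \<open>[n]\<close>.\<close>

definition op_sset :: "'x sset \<Rightarrow> 'x sset" where
  "op_sset X = \<lparr> simplices = simplices X,
                 action = (\<lambda>m n \<theta>. action X m n (\<lambda>i\<in>{..m}. n - \<theta> (m - i))) \<rparr>"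

text \<open>The edge from vertex \<open>i\<close> to vertex \<open>j\<close> of an \<open>n\<close>-simplex, where \<open>i \<le> j \<le> n\<close>.\<close>

definition edge :: "'x sset \<Rightarrow> nat \<Rightarrow> nat \<Rightarrow> nat \<Rightarrow> 'x \<Rightarrow> 'x" where
  "edge X n i j x = action X 1 n (\<lambda>k\<in>{..1}. if k = 0 then i else j) x"

definition segal :: "'x sset \<Rightarrow> nat \<Rightarrow> 'x \<Rightarrow> 'x list" where
  "segal X n x = map (\<lambda>i. edge X n (i - 1) i x) [1..<Suc n]"

definition degenerate :: "'x sset \<Rightarrow> nat \<Rightarrow> 'x \<Rightarrow> bool" where
  "degenerate X n x \<longleftrightarrow>
     (\<exists>m<n. \<exists>\<sigma>\<in>ord_maps n m. \<sigma> ` {..n} = {..m} \<and> (\<exists>z\<in>simplices X m. x = action X n m \<sigma> z))"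

definition reduced :: "'x sset \<Rightarrow> bool" where
  "reduced X \<longleftrightarrow> is_singleton (simplices X 0)"

definition edgy :: "'x sset \<Rightarrow> bool" where
  "edgy X \<longleftrightarrow> (\<forall>n\<ge>2. inj_on (segal X n) (simplices X n))"


section \<open>Chermak partial groups\<close>

text \<open>
  \<open>f n\<close> is the component of the anti-involution in degree \<open>n\<close>. The opposite of a simplicial map
  has the same components as the map itself.
\<close>

definition chermak_inversion :: "'x sset \<Rightarrow> (nat \<Rightarrow> 'x \<Rightarrow> 'x) \<Rightarrow> bool" where
  "chermak_inversion X f \<longleftrightarrow>
     simplicial_map (op_sset X) X f \<and>
     (\<forall>n. \<forall>x\<in>simplices X n. f n (f n x) = x) \<and>
     (\<forall>n. \<forall>x\<in>simplices X n. \<exists>y\<in>simplices X (2 * n).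
        segal X (2 * n) y = map (f 1) (rev (segal X n x)) @ segal X n x \<and>
        degenerate X 1 (edge X (2 * n) 0 (2 * n) y))"

definition chermak_partial_group :: "'x sset \<Rightarrow> bool" where
  "chermak_partial_group X \<longleftrightarrow>
     simplicial_set X \<and> reduced X \<and> edgy X \<and> (\<exists>f. chermak_inversion X f)"


section \<open>The simplicial set of a binary partial group\<close>

text \<open>
  A full parenthesization of a nonempty word is a binary tree whose leaves, read from left to
  right, form the word. The empty word has no parenthesization.
\<close>

datatype 'a paren = Leaf 'a | Node "'a paren" "'a paren"

fun word :: "'a paren \<Rightarrow> 'a list" where
  "word (Leaf a) = [a]"
| "word (Node s t) = word s @ word t"

fun eval :: "('a \<Rightarrow> 'a \<Rightarrow> 'a option) \<Rightarrow> 'a paren \<Rightarrow> 'a option" where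
  "eval mult (Leaf a) = Some a"
| "eval mult (Node s t) =
     (case (eval mult s, eval mult t) of (Some a, Some b) \<Rightarrow> mult a b | _ \<Rightarrow> None)"

definition has_value :: "('a \<Rightarrow> 'a \<Rightarrow> 'a option) \<Rightarrow> 'a list \<Rightarrow> 'a \<Rightarrow> bool" where
  "has_value mult w v \<longleftrightarrow> (\<forall>t. word t = w \<longrightarrow> eval mult t = Some v)"

definition word_prod :: "('a \<Rightarrow> 'a \<Rightarrow> 'a option) \<Rightarrow> 'a \<Rightarrow> 'a list \<Rightarrow> 'a" where
  "word_prod mult one w = (if w = [] then one else (THE v. has_value mult w v))"

text \<open>
  A map \<open>\<theta> : [m] \<rightarrow> [n]\<close> sends a word \<open>(a\<^sub>1, \<dots>, a\<^sub>n)\<close> to the word of length \<open>m\<close> whose entry with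
  (zero-based) index \<open>i\<close> is the product of the segment \<open>a\<^sub>j\<close>, \<open>\<theta> i < j \<le> \<theta> (i + 1)\<close>, the empty
  product being the unit. On the generating faces and degeneracies this is the usual description;
  see the lemmas below.
\<close>

definition BP :: "'a set \<Rightarrow> ('a \<Rightarrow> 'a \<Rightarrow> 'a option) \<Rightarrow> 'a \<Rightarrow> 'a list sset" where
  "BP P mult one =
     \<lparr> simplices = (\<lambda>n. {w \<in> lists P. length w = n \<and> (\<exists>v. has_value mult w v)}),
       action = (\<lambda>m n \<theta> w.
         map (\<lambda>i. word_prod mult one (take (\<theta> (Suc i) - \<theta> i) (drop (\<theta> i) w))) [0..<m]) \<rparr>"


subsection \<open>Faces and degeneracies\<close>

definition coface :: "nat \<Rightarrow> nat \<Rightarrow> nat \<Rightarrow> nat" where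
  "coface n i = (\<lambda>k\<in>{..n}. if k < i then k else Suc k)"

definition codegen :: "nat \<Rightarrow> nat \<Rightarrow> nat \<Rightarrow> nat" where
  "codegen n i = (\<lambda>k\<in>{..Suc n}. if k \<le> i then k else k - 1)"

lemma coface_in_ord_maps: "i \<le> Suc n \<Longrightarrow> coface n i \<in> ord_maps n (Suc n)"
  by (auto simp: ord_maps_def coface_def mono_on_def)

lemma codegen_in_ord_maps: "i \<le> n \<Longrightarrow> codegen n i \<in> ord_maps (Suc n) n"
  by (auto simp: ord_maps_def codegen_def mono_on_def)

lemma word_eq_Nil: "word t \<noteq> []"
  by (induction t) auto

lemma word_eq_single: "word t = [a] \<longleftrightarrow> t = Leaf a"
  by (cases t) (auto simp: append_eq_Cons_conv word_eq_Nil)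

lemma word_eq_pair: "word t = [a, b] \<longleftrightarrow> t = Node (Leaf a) (Leaf b)"
  by (cases t) (auto simp: append_eq_Cons_conv word_eq_Nil word_eq_single)

lemma word_prod_Nil: "word_prod mult one [] = one"
  by (simp add: word_prod_def)

lemma word_prod_single: "word_prod mult one [a] = a"
  by (auto simp: word_prod_def has_value_def word_eq_single intro!: the_equality)

lemma word_prod_pair: "mult a b = Some c \<Longrightarrow> word_prod mult one [a, b] = c"
  by (auto simp: word_prod_def has_value_def word_eq_pair intro!: the_equality)

lemma BP_0: "simplices (BP P mult one) 0 = {[]}"
  by (auto simp: BP_def has_value_def word_eq_Nil)

lemma BP_1: "simplices (BP P mult one) 1 = (\<lambda>a. [a]) ` P"
  by (auto simp: BP_def has_value_def length_Suc_conv word_eq_single)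

lemma (in unital_partial_magma) BP_2:
  "simplices (BP P mult one) 2 = {[a, b] |a b. mult a b \<noteq> None}"
  using mult_closed
  by (auto simp: BP_def has_value_def length_Suc_conv numeral_2_eq_2 word_eq_pair)

lemma exists_paren_extending:
  "\<exists>T. word T = u @ word t @ v \<and> (eval mult T \<noteq> None \<longrightarrow> eval mult t \<noteq> None)"
proof (induction u)
  case Nil
  show ?case
  proof (induction v rule: rev_induct)
    case Nil
    then show ?case by auto
  next
    case (snoc x xs)
    then obtain T where "word T = word t @ xs" "eval mult T \<noteq> None \<longrightarrow> eval mult t \<noteq> None"
      by auto
    then show ?case
      by (intro exI[of _ "Node T (Leaf x)"]) (auto split: option.splits)
  qed
next
  case (Cons x u)
  then obtain T where "word T = u @ word t @ v" "eval mult T \<noteq> None \<longrightarrow> eval mult t \<noteq> None"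
    by auto
  then show ?case
    by (intro exI[of _ "Node (Leaf x) T"]) (auto split: option.splits)
qed

lemma BP_adjacent_defined:
  assumes "u @ [a, b] @ v \<in> simplices (BP P mult one) n"
  shows "mult a b \<noteq> None"
proof -
  obtain T where "word T = u @ [a, b] @ v"
    "eval mult T \<noteq> None \<longrightarrow> eval mult (Node (Leaf a) (Leaf b)) \<noteq> None"
    using exists_paren_extending[of u "Node (Leaf a) (Leaf b)" v mult] by auto
  with assms show ?thesis by (auto simp: BP_def has_value_def)
qed

lemma BP_first_face:
  assumes "length w = Suc n"
  shows "action (BP P mult one) n (Suc n) (coface n 0) w = tl w"
  using assms
  by (intro nth_equalityI) (auto simp: BP_def coface_def nth_tl word_prod_single take_Suc_conv_app_nth
      simp flip: Cons_nth_drop_Suc)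

lemma BP_last_face:
  assumes "length w = Suc n"
  shows "action (BP P mult one) n (Suc n) (coface n (Suc n)) w = butlast w"
  using assms
  by (intro nth_equalityI) (auto simp: BP_def coface_def nth_butlast word_prod_single
      simp flip: Cons_nth_drop_Suc)

lemma BP_inner_face:
  assumes "length (u @ [a, b] @ v) = Suc n" "mult a b = Some c"
  shows "action (BP P mult one) n (Suc n) (coface n (Suc (length u))) (u @ [a, b] @ v)
    = u @ [c] @ v"
proof (rule nth_equalityI)
  fix i
  assume "i < length (action (BP P mult one) n (Suc n) (coface n (Suc (length u))) (u @ [a, b] @ v))"
  then have i: "i < n" by (simp add: BP_def)
  consider "i < length u" | "i = length u" | "i > length u" by linarith
  then show "action (BP P mult one) n (Suc n) (coface n (Suc (length u))) (u @ [a, b] @ v) ! i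
      = (u @ [c] @ v) ! i"
  proof cases
    case 1
    then show ?thesis using i
      by (auto simp: BP_def coface_def nth_append word_prod_single simp flip: Cons_nth_drop_Suc)
  next
    case 2
    then show ?thesis using i assms
      by (auto simp: BP_def coface_def nth_append word_prod_pair)
  next
    case 3
    define j where "j = i - Suc (length u)"
    have j: "i = Suc (length u) + j" "j < length v" using 3 i assms by (auto simp: j_def)
    then show ?thesis using i
      by (auto simp: BP_def coface_def nth_append word_prod_single simp flip: Cons_nth_drop_Suc)
  qed
qed (use assms in \<open>simp add: BP_def\<close>)

lemma BP_degeneracy:
  assumes "length (u @ v) = n"
  shows "action (BP P mult one) (Suc n) n (codegen n (length u)) (u @ v) = u @ [one] @ v"
proof (rule nth_equalityI)
  fix i
  assume "i < length (action (BP P mult one) (Suc n) n (codegen n (length u)) (u @ v))"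
  then have i: "i < Suc n" by (simp add: BP_def)
  consider "i < length u" | "i = length u" | "i > length u" by linarith
  then show "action (BP P mult one) (Suc n) n (codegen n (length u)) (u @ v) ! i
      = (u @ [one] @ v) ! i"
  proof cases
    case 1
    then show ?thesis using i
      by (auto simp: BP_def codegen_def nth_append word_prod_single simp del: upt_Suc
          simp flip: Cons_nth_drop_Suc)
  next
    case 2
    then show ?thesis using i assms
      by (auto simp: BP_def codegen_def nth_append word_prod_Nil simp del: upt_Suc)
  next
    case 3
    define j where "j = i - Suc (length u)"
    have j: "i = Suc (length u) + j" "j < length v" using 3 i assms by (auto simp: j_def)
    then show ?thesis using i
      by (auto simp: BP_def codegen_def nth_append word_prod_single simp del: upt_Suc
          simp flip: Cons_nth_drop_Suc)
  qed
qed (use assms in \<open>simp add: BP_def\<close>)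

end

theory Submission
  imports Defs
begin

text \<open>
  An \<open>n\<close>-simplex of \<open>BP\<close> is the same thing as a system of elements \<open>E i j\<close> of \<open>P\<close>, one for each
  ordered pair of vertices \<open>i, j \<le> n\<close>, such that \<open>E i j\<close> times \<open>E j k\<close> is defined and equal to
  \<open>E i k\<close> for \<^emph>\<open>all\<close> \<open>i, j, k\<close>, in whatever order; the corresponding word is
  \<open>E 0 1, E 1 2, \<dots>, E (n - 1) n\<close>.

  Given such a system, induction on trees shows that every parenthesization of a segment of the
  word evaluates to the corresponding \<open>E i j\<close>, so that the word is a simplex
  (\<open>spine_simplex\<close>). Conversely, every segment of a simplex again has a value, because an
  evaluation of the whole word determines the factors at its root by cancellation. The values of
  segments give \<open>E i j\<close> for \<open>i \<le> j\<close>, and \<open>E j i\<close> is defined as the inverse of \<open>E i j\<close>. Each equation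
  \<open>a b = c\<close> entails the five further equations obtained by permuting the vertices of a triangle with
  edges \<open>a, b, c\<close>, so this is a system as required (\<open>simplex_cases\<close>).

  A system can be reindexed along an arbitrary function \<open>\<phi> : [m] \<rightarrow> [n]\<close>, as
  \<open>E (\<phi> i) (\<phi> j)\<close>. For monotone \<open>\<phi>\<close> this is the action on \<open>BP\<close> (\<open>action_spine\<close>), which makes
  functoriality evident. For \<open>\<phi> i = n - i\<close> it is the
  inversion \<open>(a\<^sub>1, \<dots>, a\<^sub>n) \<mapsto> (a\<^sub>n\<^sup>\<dagger>, \<dots>, a\<^sub>1\<^sup>\<dagger>)\<close>. For \<open>\<phi> : [2n] \<rightarrow> [n]\<close>, \<open>\<phi> i = \<bar>n - i\<bar>\<close>, it is the
  word \<open>(a\<^sub>n\<^sup>\<dagger>, \<dots>, a\<^sub>1\<^sup>\<dagger>, a\<^sub>1, \<dots>, a\<^sub>n)\<close>, whose total product is \<open>E n n = 1\<close>.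
\<close>

section \<open>Values of words\<close>

lemma exists_paren: "w \<noteq> [] \<Longrightarrow> \<exists>t. word t = w"
proof (induction w)
  case (Cons a w)
  show ?case
  proof (cases "w = []")
    case True
    then show ?thesis by (auto simp: word_eq_single)
  next
    case False
    then obtain t where "word t = w" using Cons.IH by auto
    then show ?thesis by (intro exI[of _ "Node (Leaf a) t"]) simp
  qed
qed simp

lemma word_prod_eqI:
  assumes "w \<noteq> []" "has_value mult w v"
  shows "word_prod mult one w = v"
proof -
  obtain t where t: "word t = w" using exists_paren assms(1) by blast
  have "eval mult t = Some v'" if "has_value mult w v'" for v'
    using that t by (simp add: has_value_def)
  then have "(THE v. has_value mult w v) = v"
    using assms(2) by (metis (mono_tags) option.inject the_equality)
  then show ?thesis using assms(1) by (simp add: word_prod_def)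
qed

lemma eval_Node_eq_Some:
  "eval mult (Node s t) = Some c \<longleftrightarrow>
    (\<exists>a b. eval mult s = Some a \<and> eval mult t = Some b \<and> mult a b = Some c)"
  by (auto split: option.splits)


section \<open>Inverses in a binary partial group\<close>

context binary_partial_group
begin

text \<open>The inverse \<open>a\<^sup>\<dagger>\<close> of an element \<open>a\<close> of \<open>P\<close>; the value outside \<open>P\<close> is irrelevant.\<close>

definition dagger :: "'a \<Rightarrow> 'a" where
  "dagger a = (SOME a'. a' \<in> P \<and> (\<forall>b\<in>P.
      (\<forall>c. mult a b = Some c \<longrightarrow> mult a' c = Some b) \<and>
      (\<forall>c. mult b a = Some c \<longrightarrow> mult c a' = Some b)))"

lemma dagger_spec:
  assumes "a \<in> P"
  shows "dagger a \<in> P \<and> (\<forall>b\<in>P.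
      (\<forall>c. mult a b = Some c \<longrightarrow> mult (dagger a) c = Some b) \<and>
      (\<forall>c. mult b a = Some c \<longrightarrow> mult c (dagger a) = Some b))"
  unfolding dagger_def by (rule someI_ex) (use dagger_exists[OF assms] in blast)

lemma dagger_closed: "a \<in> P \<Longrightarrow> dagger a \<in> P"
  using dagger_spec by blast

lemma dagger_left: "mult a b = Some c \<Longrightarrow> mult (dagger a) c = Some b"
  using dagger_spec mult_closed by blast

lemma dagger_right: "mult a b = Some c \<Longrightarrow> mult c (dagger b) = Some a"
  using dagger_spec mult_closed by blast

lemma dagger_mult: "a \<in> P \<Longrightarrow> mult (dagger a) a = Some one"
  by (rule dagger_left) (rule mult_one)

lemma dagger_dagger: "a \<in> P \<Longrightarrow> dagger (dagger a) = a"
  using dagger_left[OF dagger_mult[of a]] mult_one dagger_closed by fastforce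

text \<open>The remaining edge equations of a triangle with edges \<open>a, b, c\<close> when its vertices are permuted.\<close>

lemma mult_dagger_right: "mult a b = Some c \<Longrightarrow> mult b (dagger c) = Some (dagger a)"
  by (rule dagger_right[OF dagger_left])

lemma dagger_mult_dagger: "mult a b = Some c \<Longrightarrow> mult (dagger b) (dagger a) = Some (dagger c)"
  by (rule dagger_left[OF mult_dagger_right])

lemma mult_dagger_left: "mult a b = Some c \<Longrightarrow> mult (dagger c) a = Some (dagger b)"
  using dagger_left[OF dagger_right] .

lemma idempotent_eq_one:
  assumes "mult a a = Some a"
  shows "a = one"
proof -
  have "a \<in> P" using assms mult_closed by blast
  then show ?thesis using dagger_left[OF assms] dagger_mult by simp
qed


section \<open>Words with a well-defined product\<close>

text \<open>
  The words over \<open>P\<close> all of whose parenthesizations have a common value, that is, the simplices of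
  \<open>BP\<close> of any dimension. The empty word is included: it has no parenthesization, and every element
  is vacuously a value of it.
\<close>

definition valid :: "'a list \<Rightarrow> bool" where
  "valid w \<longleftrightarrow> w \<in> lists P \<and> (\<exists>v. has_value mult w v)"

abbreviation wprod :: "'a list \<Rightarrow> 'a" where
  "wprod \<equiv> word_prod mult one"

abbreviation B :: "'a list sset" where
  "B \<equiv> BP P mult one"

lemma simplices_B: "simplices B n = {w. valid w \<and> length w = n}"
  by (auto simp: BP_def valid_def)

lemma valid_Nil: "valid []"
  by (auto simp: valid_def has_value_def word_eq_Nil)

lemma eval_closed: "word t \<in> lists P \<Longrightarrow> eval mult t = Some v \<Longrightarrow> v \<in> P"
  by (cases t) (auto simp: mult_closed split: option.splits)

lemma wprod_closed:
  assumes "valid w"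
  shows "wprod w \<in> P"
proof (cases "w = []")
  case True
  then show ?thesis by (simp add: word_prod_Nil one_closed)
next
  case False
  then obtain t where t: "word t = w" using exists_paren by blast
  obtain v where v: "has_value mult w v" using assms by (auto simp: valid_def)
  then have "eval mult t = Some v" using t by (simp add: has_value_def)
  then show ?thesis
    using assms t word_prod_eqI[OF False v] eval_closed by (metis valid_def)
qed

text \<open>
  Cancellation makes the value of either factor independent of its parenthesization: with the other
  factor fixed, it can be recovered from the total product.
\<close>

lemma has_value_append:
  assumes "u \<noteq> []" "v \<noteq> []" "has_value mult (u @ v) c"
  shows "\<exists>a b. has_value mult u a \<and> has_value mult v b \<and> mult a b = Some c"
proof -
  have total: "eval mult (Node s t) = Some c" if "word s = u" "word t = v" for s t
    using assms(3) that by (auto simp: has_value_def simp del: eval.simps)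
  obtain s t where st: "word s = u" "word t = v" using exists_paren assms by metis
  obtain a b where ab: "eval mult s = Some a" "eval mult t = Some b" "mult a b = Some c"
    using total[OF st] unfolding eval_Node_eq_Some by blast
  have "eval mult s' = Some a" if s': "word s' = u" for s'
  proof -
    obtain a' where "eval mult s' = Some a'" "mult a' b = Some c"
      using total[OF s' st(2)] ab(2) unfolding eval_Node_eq_Some by auto
    then show ?thesis using dagger_right[of a' b c] dagger_right[OF ab(3)] by simp
  qed
  moreover have "eval mult t' = Some b" if t': "word t' = v" for t'
  proof -
    obtain b' where "eval mult t' = Some b'" "mult a b' = Some c"
      using total[OF st(1) t'] ab(1) unfolding eval_Node_eq_Some by auto
    then show ?thesis using dagger_left[of a b' c] dagger_left[OF ab(3)] by simp
  qed
  ultimately show ?thesis using ab(3) by (auto simp: has_value_def)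
qed

lemma valid_append:
  assumes "valid (u @ v)"
  shows "valid u" "valid v"
proof -
  have "valid u \<and> valid v"
  proof (cases "u = [] \<or> v = []")
    case True
    then show ?thesis using assms valid_Nil by auto
  next
    case False
    obtain c where "has_value mult (u @ v) c" using assms unfolding valid_def by blast
    then obtain a b where "has_value mult u a" "has_value mult v b"
      using has_value_append False by blast
    then show ?thesis using assms unfolding valid_def by auto
  qed
  then show "valid u" "valid v" by auto
qed

lemma wprod_append:
  assumes "valid (u @ v)"
  shows "mult (wprod u) (wprod v) = Some (wprod (u @ v))"
proof (cases "u = [] \<or> v = []")
  case True
  then show ?thesis using wprod_closed[OF assms] by (auto simp: word_prod_Nil one_mult mult_one)
next
  case False
  obtain c where c: "has_value mult (u @ v) c" using assms unfolding valid_def by blast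
  then obtain a b where "has_value mult u a" "has_value mult v b" "mult a b = Some c"
    using has_value_append False by blast
  then show ?thesis using False c by (simp add: word_prod_eqI)
qed


section \<open>Simplices as systems of edges\<close>

text \<open>
  The elements \<open>E i j\<close>, for vertices \<open>i, j \<le> n\<close>, form an edge system if they compose without any
  condition on the order of the vertices. In particular \<open>E i i\<close> is the unit and \<open>E j i\<close> is the
  inverse of \<open>E i j\<close>.
\<close>

definition edge_system :: "nat \<Rightarrow> (nat \<Rightarrow> nat \<Rightarrow> 'a) \<Rightarrow> bool" where
  "edge_system n E \<longleftrightarrow> (\<forall>i\<le>n. \<forall>j\<le>n. \<forall>k\<le>n. mult (E i j) (E j k) = Some (E i k))"

text \<open>The word formed by the edges between consecutive vertices.\<close>

definition spine :: "nat \<Rightarrow> (nat \<Rightarrow> nat \<Rightarrow> 'a) \<Rightarrow> 'a list" where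
  "spine n E = map (\<lambda>i. E i (Suc i)) [0..<n]"

lemma edge_system_mult:
  "edge_system n E \<Longrightarrow> i \<le> n \<Longrightarrow> j \<le> n \<Longrightarrow> k \<le> n \<Longrightarrow> mult (E i j) (E j k) = Some (E i k)"
  by (simp add: edge_system_def)

lemma edge_system_closed: "edge_system n E \<Longrightarrow> i \<le> n \<Longrightarrow> j \<le> n \<Longrightarrow> E i j \<in> P"
  using edge_system_mult mult_closed by blast

lemma edge_system_refl: "edge_system n E \<Longrightarrow> i \<le> n \<Longrightarrow> E i i = one"
  using edge_system_mult idempotent_eq_one by blast

lemma edge_system_dagger:
  assumes "edge_system n E" "i \<le> n" "j \<le> n"
  shows "dagger (E i j) = E j i"
proof -
  have "mult (dagger (E i j)) one = Some (E j i)"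
    using dagger_left[OF edge_system_mult[OF assms assms(2)]] edge_system_refl[OF assms(1,2)] by simp
  then show ?thesis using mult_one dagger_closed edge_system_closed[OF assms] by simp
qed

lemma edge_system_reindex:
  assumes "edge_system n E" "\<And>i. i \<le> m \<Longrightarrow> \<phi> i \<le> n"
  shows "edge_system m (\<lambda>i j. E (\<phi> i) (\<phi> j))"
  using assms by (simp add: edge_system_def)

lemma length_spine [simp]: "length (spine n E) = n"
  by (simp add: spine_def)

lemma spine_nth: "i < n \<Longrightarrow> spine n E ! i = E i (Suc i)"
  by (simp add: spine_def)

lemma spine_cong:
  "(\<And>i. i < n \<Longrightarrow> E i (Suc i) = F i (Suc i)) \<Longrightarrow> spine n E = spine n F"
  by (simp add: spine_def)

lemma eval_spine:
  assumes "edge_system n E"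
  shows "word t = map (\<lambda>l. E l (Suc l)) [i..<j] \<Longrightarrow> i \<le> j \<Longrightarrow> j \<le> n \<Longrightarrow> eval mult t = Some (E i j)"
proof (induction t arbitrary: i j)
  case (Leaf a)
  have "length [a] = j - i" using Leaf.prems(1) by (metis length_map length_upt word.simps(1))
  then have "j = Suc i" by simp
  then show ?case using Leaf.prems by simp
next
  case (Node s t)
  define k where "k = i + length (word s)"
  have "length (word s @ word t) = j - i" using Node.prems by simp
  then have k: "i \<le> k" "k \<le> j" using Node.prems by (auto simp: k_def)
  then have "[i..<j] = [i..<k] @ [k..<j]" using upt_add_eq_append[of i k "j - k"] by simp
  then have "word s @ word t = map (\<lambda>l. E l (Suc l)) [i..<k] @ map (\<lambda>l. E l (Suc l)) [k..<j]"
    using Node.prems by simp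
  moreover have "length (word s) = length (map (\<lambda>l. E l (Suc l)) [i..<k])"
    by (simp add: k_def)
  ultimately have "word s = map (\<lambda>l. E l (Suc l)) [i..<k] \<and> word t = map (\<lambda>l. E l (Suc l)) [k..<j]"
    using append_eq_append_conv by blast
  then have "eval mult s = Some (E i k)" "eval mult t = Some (E k j)"
    using Node k by auto
  then show ?case using edge_system_mult[OF assms, of i k j] k Node.prems by simp
qed

lemma spine_simplex:
  assumes "edge_system n E"
  shows "spine n E \<in> simplices B n"
proof -
  have "has_value mult (spine n E) (E 0 n)"
    unfolding has_value_def spine_def using eval_spine[OF assms, of _ 0 n] by simp
  moreover have "spine n E \<in> lists P"
    using edge_system_closed[OF assms] by (auto simp: spine_def)
  ultimately show ?thesis by (auto simp: simplices_B valid_def)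
qed

lemma wprod_spine_segment:
  assumes "edge_system n E" "i \<le> j" "j \<le> n"
  shows "wprod (take (j - i) (drop i (spine n E))) = E i j"
proof -
  have seg: "take (j - i) (drop i (spine n E)) = map (\<lambda>l. E l (Suc l)) [i..<j]"
    using assms by (simp add: spine_def drop_map take_map drop_upt take_upt)
  show ?thesis
  proof (cases "i = j")
    case True
    then show ?thesis using assms by (simp add: word_prod_Nil edge_system_refl)
  next
    case False
    then show ?thesis
      unfolding seg using eval_spine[OF assms(1)] assms
      by (intro word_prod_eqI) (auto simp: has_value_def)
  qed
qed

text \<open>
  Elements that compose along increasing vertices extend to an edge system, with inverses on the
  decreasing pairs.
\<close>

lemma edge_system_extend:
  assumes "\<And>i j k. i \<le> j \<Longrightarrow> j \<le> k \<Longrightarrow> k \<le> n \<Longrightarrow> mult (p i j) (p j k) = Some (p i k)"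
  shows "edge_system n (\<lambda>i j. if i \<le> j then p i j else dagger (p j i))"
  unfolding edge_system_def
proof (intro allI impI)
  fix i j k assume n: "i \<le> n" "j \<le> n" "k \<le> n"
  show "mult (if i \<le> j then p i j else dagger (p j i)) (if j \<le> k then p j k else dagger (p k j))
    = Some (if i \<le> k then p i k else dagger (p k i))"
  proof (cases "i \<le> j")
    case True
    consider "j \<le> k" | "i \<le> k" "k < j" | "k < i" by linarith
    then show ?thesis
    proof cases
      case 1
      then show ?thesis using True n assms[of i j k] by simp
    next
      case 2
      then show ?thesis using True n dagger_right[OF assms[of i k j]] by simp
    next
      case 3
      then show ?thesis using True n mult_dagger_right[OF assms[of k i j]] by simp
    qed
  next
    case False
    consider "i \<le> k" | "j \<le> k" "k < i" | "k < j" by linarith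
    then show ?thesis
    proof cases
      case 1
      then show ?thesis using False n dagger_left[OF assms[of j i k]] by simp
    next
      case 2
      then show ?thesis using False n mult_dagger_left[OF assms[of j k i]] by simp
    next
      case 3
      then show ?thesis using False n dagger_mult_dagger[OF assms[of k j i]] by simp
    qed
  qed
qed

lemma simplex_cases:
  assumes "w \<in> simplices B n"
  obtains E where "edge_system n E" "w = spine n E"
proof -
  have w: "valid w" "length w = n" using assms by (auto simp: simplices_B)
  define p where "p i j = wprod (take (j - i) (drop i w))" for i j
  let ?E = "\<lambda>i j. if i \<le> j then p i j else dagger (p j i)"
  have "mult (p i j) (p j k) = Some (p i k)" if "i \<le> j" "j \<le> k" "k \<le> n" for i j k
  proof -
    have "take (k - i) (drop i w) = take (j - i) (drop i w) @ take (k - j) (drop j w)"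
      using that take_add[of "j - i" "k - j" "drop i w"] by simp
    moreover have "valid (take (k - i) (drop i w))"
      using w(1) valid_append by (metis append_take_drop_id)
    ultimately show ?thesis unfolding p_def using wprod_append by simp
  qed
  then have "edge_system n ?E" by (rule edge_system_extend)
  moreover have "w = spine n ?E"
    using w(2)
    by (intro nth_equalityI)
      (auto simp: spine_nth p_def word_prod_single simp flip: Cons_nth_drop_Suc)
  ultimately show ?thesis using that by blast
qed


section \<open>The simplicial structure\<close>

lemma ord_maps_le: "\<theta> \<in> ord_maps m n \<Longrightarrow> i \<le> m \<Longrightarrow> \<theta> i \<le> n"
  by (auto simp: ord_maps_def)

lemma action_spine:
  assumes "edge_system n E" "\<theta> \<in> ord_maps m n"
  shows "action B m n \<theta> (spine n E) = spine m (\<lambda>i j. E (\<theta> i) (\<theta> j))"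
proof (rule nth_equalityI)
  fix i assume "i < length (action B m n \<theta> (spine n E))"
  then have i: "i < m" by (simp add: BP_def)
  then have "\<theta> i \<le> \<theta> (Suc i)" "\<theta> (Suc i) \<le> n"
    using assms(2) by (auto simp: ord_maps_def mono_on_def)
  note segment = wprod_spine_segment[OF assms(1) this]
  show "action B m n \<theta> (spine n E) ! i = spine m (\<lambda>i j. E (\<theta> i) (\<theta> j)) ! i"
    using i by (simp add: BP_def spine_nth segment)
qed (simp add: BP_def)

lemma edge_system_action:
  "edge_system n E \<Longrightarrow> \<theta> \<in> ord_maps m n \<Longrightarrow> edge_system m (\<lambda>i j. E (\<theta> i) (\<theta> j))"
  by (rule edge_system_reindex[where \<phi> = \<theta>]) (auto dest: ord_maps_le)

lemma simplicial_set_B: "simplicial_set B"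
  unfolding simplicial_set_def
proof (intro conjI allI ballI)
  fix m n \<theta> assume \<theta>: "\<theta> \<in> ord_maps m n"
  show "action B m n \<theta> \<in> simplices B n \<rightarrow> simplices B m"
  proof
    fix w assume "w \<in> simplices B n"
    then obtain E where E: "edge_system n E" "w = spine n E" by (rule simplex_cases)
    show "action B m n \<theta> w \<in> simplices B m"
      unfolding E(2) action_spine[OF E(1) \<theta>]
      by (rule spine_simplex[OF edge_system_action[OF E(1) \<theta>]])
  qed
next
  fix n w assume "w \<in> simplices B n"
  then obtain E where E: "edge_system n E" "w = spine n E" by (rule simplex_cases)
  have \<theta>: "(\<lambda>i\<in>{..n}. i) \<in> ord_maps n n" by (auto simp: ord_maps_def mono_on_def)
  show "action B n n (\<lambda>i\<in>{..n}. i) w = w"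
    unfolding E(2) action_spine[OF E(1) \<theta>] by (rule spine_cong) simp
next
  fix k m n \<phi> \<theta> w
  assume \<phi>: "\<phi> \<in> ord_maps k m" and \<theta>: "\<theta> \<in> ord_maps m n" and "w \<in> simplices B n"
  then obtain E where E: "edge_system n E" "w = spine n E" by (metis simplex_cases)
  have \<theta>\<phi>: "compose {..k} \<theta> \<phi> \<in> ord_maps k n"
    using \<phi> \<theta> by (auto simp: ord_maps_def mono_on_def compose_def PiE_iff)
  show "action B k n (compose {..k} \<theta> \<phi>) w = action B k m \<phi> (action B m n \<theta> w)"
    unfolding E(2) action_spine[OF E(1) \<theta>\<phi>] action_spine[OF E(1) \<theta>]
      action_spine[OF edge_system_action[OF E(1) \<theta>] \<phi>]
    by (rule spine_cong) (simp add: compose_def)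
qed

lemma edge_spine:
  assumes "edge_system n E" "i \<le> j" "j \<le> n"
  shows "edge B n i j (spine n E) = [E i j]"
proof -
  have \<theta>: "(\<lambda>k\<in>{..1}. if k = 0 then i else j) \<in> ord_maps 1 n"
    using assms by (auto simp: ord_maps_def mono_on_def)
  show ?thesis
    unfolding edge_def action_spine[OF assms(1) \<theta>] by (simp add: spine_def)
qed

lemma segal_B:
  assumes "w \<in> simplices B n"
  shows "segal B n w = map (\<lambda>a. [a]) w"
proof -
  obtain E where E: "edge_system n E" "w = spine n E" using assms by (rule simplex_cases)
  have "segal B n w = map (\<lambda>i. [E (i - 1) i]) [Suc 0..<Suc n]"
    unfolding segal_def E(2) using edge_spine[OF E(1)] by (simp del: upt_Suc)
  also have "\<dots> = map (\<lambda>a. [a]) w"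
    unfolding E(2) spine_def map_Suc_upt[symmetric] by simp
  finally show ?thesis .
qed

lemma edgy_B: "edgy B"
  unfolding edgy_def
proof (intro allI impI inj_onI)
  fix n v w assume "v \<in> simplices B n" "w \<in> simplices B n" "segal B n v = segal B n w"
  then have "map (\<lambda>a. [a]) v = map (\<lambda>a. [a]) w" by (simp add: segal_B)
  then show "v = w" by (rule map_injective) (simp add: inj_def)
qed


section \<open>The inversion\<close>

text \<open>
  The inversion \<open>(a\<^sub>1, \<dots>, a\<^sub>n) \<mapsto> (a\<^sub>n\<^sup>\<dagger>, \<dots>, a\<^sub>1\<^sup>\<dagger>)\<close>, defined on words of all lengths at once.
\<close>

definition inversion :: "'a list \<Rightarrow> 'a list" where
  "inversion w = rev (map dagger w)"

lemma inversion_spine: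
  assumes "edge_system n E"
  shows "inversion (spine n E) = spine n (\<lambda>i j. E (n - i) (n - j))"
proof (rule nth_equalityI)
  fix i assume "i < length (inversion (spine n E))"
  then have i: "i < n" by (simp add: inversion_def)
  \<comment> \<open>The entry at position \<open>i\<close> from the right joins the vertices \<open>n - i - 1\<close> and \<open>n - i\<close>.\<close>
  then have "Suc (n - Suc i) = n - i" by simp
  then show "inversion (spine n E) ! i = spine n (\<lambda>i j. E (n - i) (n - j)) ! i"
    using i by (simp add: inversion_def rev_nth spine_nth edge_system_dagger[OF assms])
qed (simp add: inversion_def)

lemma simplicial_map_inversion: "simplicial_map (op_sset B) B (\<lambda>_. inversion)"
  unfolding simplicial_map_def
proof (intro conjI allI ballI)
  fix n
  show "inversion \<in> simplices (op_sset B) n \<rightarrow> simplices B n"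
  proof
    fix w assume "w \<in> simplices (op_sset B) n"
    then have "w \<in> simplices B n" by (simp add: op_sset_def)
    then obtain E where E: "edge_system n E" "w = spine n E" by (rule simplex_cases)
    have "edge_system n (\<lambda>i j. E (n - i) (n - j))" by (rule edge_system_reindex[OF E(1)]) simp
    then show "inversion w \<in> simplices B n" using E by (simp add: inversion_spine spine_simplex)
  qed
next
  fix m n \<theta> w assume \<theta>: "\<theta> \<in> ord_maps m n" and "w \<in> simplices (op_sset B) n"
  then have "w \<in> simplices B n" by (simp add: op_sset_def)
  then obtain E where E: "edge_system n E" "w = spine n E" by (rule simplex_cases)
  let ?\<theta> = "\<lambda>i\<in>{..m}. n - \<theta> (m - i)"
  have \<theta>': "?\<theta> \<in> ord_maps m n"
    using \<theta> by (auto simp: ord_maps_def mono_on_def intro!: diff_le_mono2)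
  have E': "edge_system n (\<lambda>i j. E (n - i) (n - j))" by (rule edge_system_reindex[OF E(1)]) simp
  have "inversion (action (op_sset B) m n \<theta> w) = spine m (\<lambda>i j. E (?\<theta> (m - i)) (?\<theta> (m - j)))"
    using action_spine[OF E(1) \<theta>'] inversion_spine[OF edge_system_action[OF E(1) \<theta>']] E(2)
    by (simp add: op_sset_def)
  also have "\<dots> = spine m (\<lambda>i j. E (n - \<theta> i) (n - \<theta> j))"
    by (intro spine_cong) auto
  also have "\<dots> = action B m n \<theta> (inversion w)"
    using action_spine[OF E' \<theta>] E by (simp add: inversion_spine)
  finally show "inversion (action (op_sset B) m n \<theta> w) = action B m n \<theta> (inversion w)" .
qed

lemma inversion_inversion: "w \<in> simplices B n \<Longrightarrow> inversion (inversion w) = w"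
  by (auto simp: inversion_def rev_map simplices_B valid_def dagger_dagger
      intro!: map_idI)

text \<open>The witness required of an inversion is the word of inverses followed by the word itself.\<close>

lemma inversion_append_simplex:
  assumes "w \<in> simplices B n"
  shows "inversion w @ w \<in> simplices B (2 * n)"
    and "edge B (2 * n) 0 (2 * n) (inversion w @ w) = [one]"
proof -
  obtain E where E: "edge_system n E" "w = spine n E" using assms by (rule simplex_cases)
  \<comment> \<open>This is \<open>\<bar>n - i\<bar>\<close>: the vertices run from \<open>n\<close> down to \<open>0\<close> and back up to \<open>n\<close>.\<close>
  define \<phi> where "\<phi> i = (if i \<le> n then n - i else i - n)" for i
  have F: "edge_system (2 * n) (\<lambda>i j. E (\<phi> i) (\<phi> j))"
    by (rule edge_system_reindex[OF E(1)]) (auto simp: \<phi>_def)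
  have eq: "inversion w @ w = spine (2 * n) (\<lambda>i j. E (\<phi> i) (\<phi> j))"
    unfolding E(2) inversion_spine[OF E(1)]
  proof (rule nth_equalityI)
    fix i assume "i < length (spine n (\<lambda>i j. E (n - i) (n - j)) @ spine n E)"
    then show "(spine n (\<lambda>i j. E (n - i) (n - j)) @ spine n E) ! i
      = spine (2 * n) (\<lambda>i j. E (\<phi> i) (\<phi> j)) ! i"
      by (auto simp: nth_append spine_nth \<phi>_def Suc_diff_le)
  qed simp
  show "inversion w @ w \<in> simplices B (2 * n)" unfolding eq using F by (rule spine_simplex)
  have "\<phi> 0 = n" "\<phi> (2 * n) = n" by (auto simp: \<phi>_def)
  then show "edge B (2 * n) 0 (2 * n) (inversion w @ w) = [one]"
    unfolding eq edge_spine[OF F le0 order_refl] by (simp add: edge_system_refl[OF E(1)])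
qed

lemma degenerate_unit: "degenerate B 1 [one]"
  unfolding degenerate_def
proof (intro exI[of _ 0] conjI bexI[of _ "\<lambda>k\<in>{..1}. 0"] bexI[of _ "[]"])
  show "[one] = action B 1 0 (\<lambda>k\<in>{..1}. 0) []" by (simp add: BP_def word_prod_Nil)
qed (auto simp: ord_maps_def mono_on_def BP_0)

lemma chermak_inversion_B: "chermak_inversion B (\<lambda>_. inversion)"
  unfolding chermak_inversion_def
proof (intro conjI allI ballI)
  fix n w assume w: "w \<in> simplices B n"
  show "inversion (inversion w) = w" using w by (rule inversion_inversion)
  note y = inversion_append_simplex[OF w]
  have "segal B (2 * n) (inversion w @ w) = map inversion (rev (segal B n w)) @ segal B n w"
    unfolding segal_B[OF y(1)] segal_B[OF w] by (simp add: inversion_def rev_map)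
  then show "\<exists>y\<in>simplices B (2 * n).
      segal B (2 * n) y = map inversion (rev (segal B n w)) @ segal B n w \<and>
      degenerate B 1 (edge B (2 * n) 0 (2 * n) y)"
    using y degenerate_unit by metis
qed (rule simplicial_map_inversion)

end


theorem corollary8:
  fixes P :: "'a set" and mult :: "'a \<Rightarrow> 'a \<Rightarrow> 'a option" and one :: 'a
  assumes "binary_partial_group P mult one"
  shows "chermak_partial_group (BP P mult one)"
proof -
  interpret binary_partial_group P mult one by (rule assms)
  have "reduced B" by (simp add: reduced_def BP_0)
  then show ?thesis
    unfolding chermak_partial_group_def
    using simplicial_set_B edgy_B chermak_inversion_B by blast
qed

end
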